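(* There is a randomized algorithm which, given the vertex set $V(G)$ of a graph $G$ (whose edges are unknown) that is promised to have a vertex cover of size at most $k$, the positive integer $k$, and access to a BISE oracle for $G$, makes $\mathcal{O}(k^2\log k)$ BISE queries and, with probability at least $1-1/k^{c}$ for some constant $c>0$, outputs a vertex cover of $G$ of size at most $k$.
   Context: The BISE oracle takes as input two disjoint non-empty subsets $A,B\subseteq V(G)$ and returns some edge $(u,v)\in E(G)$ with $u\in A$, $v\in B$ if one exists (an arbitrary such edge), and NULL otherwise. A vertex cover is a set of vertices containing at least one endpoint of every edge. Only oracle queries are counted. *)

theory Defs
  imports
    "HOL-Probability.Probability_Mass_Function"
    "HOL-Library.Landau_Symbols"
    "Graph_Theory.Pair_Digraph"
begin

text \<open>
  Graphs are finite simple graphs, represented by \<^const>\<open>pair_graph\<close>: an undirected edge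
  between \<open>u\<close> and \<open>v\<close> is the pair of arcs \<open>(u, v)\<close> and \<open>(v, u)\<close>.
\<close>

definition vertex_cover :: "'v pair_pre_digraph \<Rightarrow> 'v set \<Rightarrow> bool" where
  "vertex_cover G S \<longleftrightarrow>
     S \<subseteq> pverts G \<and> (\<forall>u v. (u, v) \<in> parcs G \<longrightarrow> u \<in> S \<or> v \<in> S)"

definition legal_query :: "'v set \<Rightarrow> 'v set \<Rightarrow> 'v set \<Rightarrow> bool" where
  "legal_query V A B \<longleftrightarrow> A \<subseteq> V \<and> B \<subseteq> V \<and> A \<noteq> {} \<and> B \<noteq> {} \<and> A \<inter> B = {}"

text \<open>An answer is \<^const>\<open>None\<close> for NULL, or an edge with first end in the first query set.\<close>

type_synonym 'v answer = "('v \<times> 'v) option"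

definition BISE_answer :: "'v pair_pre_digraph \<Rightarrow> 'v set \<Rightarrow> 'v set \<Rightarrow> 'v answer \<Rightarrow> bool" where
  "BISE_answer G A B r \<longleftrightarrow>
     (case r of
        None \<Rightarrow> \<not> (\<exists>u\<in>A. \<exists>v\<in>B. (u, v) \<in> parcs G)
      | Some (u, v) \<Rightarrow> u \<in> A \<and> v \<in> B \<and> (u, v) \<in> parcs G)"

type_synonym 'v transcript = "(('v set \<times> 'v set) \<times> 'v answer) list"

text \<open>
  The returned edge is arbitrary at every single query: it may depend on all earlier queries
  and answers, so an oracle is a function of the transcript so far and the current query.
  Nothing is promised about illegal queries.
\<close>

type_synonym 'v query_oracle = "'v transcript \<Rightarrow> 'v set \<Rightarrow> 'v set \<Rightarrow> 'v answer"

definition BISE_oracle :: "'v pair_pre_digraph \<Rightarrow> 'v query_oracle \<Rightarrow> bool" where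
  "BISE_oracle G orc \<longleftrightarrow>
     (\<forall>h A B. legal_query (pverts G) A B \<longrightarrow> BISE_answer G A B (orc h A B))"

text \<open>
  A deterministic adaptive query algorithm is a well-founded decision tree. A randomized one is
  a probability distribution over such trees, i.e. all coins are drawn in advance and are
  hidden from the oracle. Computation between queries is unrestricted.
\<close>

datatype ('v, 'o) query_alg =
    Output 'o
  | Query "'v set" "'v set" "'v answer \<Rightarrow> ('v, 'o) query_alg"

primrec exec_from ::
  "'v query_oracle \<Rightarrow> ('v, 'o) query_alg \<Rightarrow> 'v transcript \<Rightarrow> 'v transcript \<times> 'o" where
  "exec_from orc (Output x) h = (h, x)"
| "exec_from orc (Query A B next) h =
     (let r = orc h A B in exec_from orc (next r) (h @ [((A, B), r)]))"

definition transcript :: "'v query_oracle \<Rightarrow> ('v, 'o) query_alg \<Rightarrow> 'v transcript" where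
  "transcript orc t = fst (exec_from orc t [])"

definition result :: "'v query_oracle \<Rightarrow> ('v, 'o) query_alg \<Rightarrow> 'o" where
  "result orc t = snd (exec_from orc t [])"

definition num_queries :: "'v query_oracle \<Rightarrow> ('v, 'o) query_alg \<Rightarrow> nat" where
  "num_queries orc t = length (transcript orc t)"

definition legal_run :: "'v set \<Rightarrow> 'v query_oracle \<Rightarrow> ('v, 'o) query_alg \<Rightarrow> bool" where
  "legal_run V orc t \<longleftrightarrow> (\<forall>((A, B), r) \<in> set (transcript orc t). legal_query V A B)"

end

theory Submission
  imports Defs
begin

text \<open>
  A uniformly random bipartition of the vertices not matched so far separates the ends of a fixed
  remaining edge with probability \<open>1/2\<close>, and every edge returned takes a vertex of an optimal
  cover \<open>S\<close> out of the remaining graph. With \<open>j\<close> vertices of \<open>S\<close> left, the potential \<open>2 ^ j\<close>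
  therefore shrinks in expectation by a factor \<open>(1 + 1/2) / 2 = 3/4\<close> per query, so after \<open>5 k\<close>
  bipartitions the matching fails to be maximal with probability at most
  \<open>2 ^ k * (3/4) ^ (5 k) \<le> 1/k\<close>, whatever the oracle does.
  The vertices of a maximal matching cover all edges. Querying one matched vertex against the
  vertices not yet known to be its neighbours, at most \<open>k + 1\<close> times, finds either all its
  neighbours or \<open>k + 1\<close> of them, which forces the vertex into every cover of size at most \<open>k\<close>.
  Hence the covers of size at most \<open>k\<close> of the discovered edges are exactly those of the graph.
\<close>

section \<open>Worst-case guarantees of decision trees\<close>

text \<open>Quantifying over all admissible answers removes the oracle and its memory, so bounds
  follow by induction on the tree alone; \<open>n\<close> is the query budget left.\<close>

primrec guarantees ::
  "'v pair_pre_digraph \<Rightarrow> ('o \<Rightarrow> bool) \<Rightarrow> ('v, 'o) query_alg \<Rightarrow> nat \<Rightarrow> bool" where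
  "guarantees G Q (Output x) n \<longleftrightarrow> Q x"
| "guarantees G Q (Query A B next) n \<longleftrightarrow> 0 < n \<and> legal_query (pverts G) A B \<and>
     (\<forall>r. BISE_answer G A B r \<longrightarrow> guarantees G Q (next r) (n - 1))"

lemma guarantees_mono:
  assumes "guarantees G Q t m" "m \<le> n" "\<And>x. Q x \<Longrightarrow> Q' x"
  shows "guarantees G Q' t n"
  using assms(1,2)
proof (induction t arbitrary: m n)
  case (Output x)
  then show ?case using assms(3) by simp
next
  case (Query A B nxt)
  have "guarantees G Q' (nxt r) (n - 1)" if "BISE_answer G A B r" for r
    using Query.prems that by (intro Query.IH[of "nxt r" "m - 1" "n - 1"]) auto
  then show ?case using Query.prems by auto
qed

text \<open>A run follows one branch of admissible answers. The past \<open>h\<close> stays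
  arbitrary because the oracle may react to it.\<close>

lemma guarantees_exec:
  assumes "BISE_oracle G orc" "guarantees G Q t n"
  shows "Q (snd (exec_from orc t h)) \<and>
    (\<exists>h'. fst (exec_from orc t h) = h @ h' \<and> length h' \<le> n \<and>
       (\<forall>((A, B), r) \<in> set h'. legal_query (pverts G) A B))"
  using assms(2)
proof (induction t arbitrary: n h)
  case (Output x)
  then show ?case by simp
next
  case (Query A B nxt)
  let ?r = "orc h A B"
  have legal: "legal_query (pverts G) A B" and n: "0 < n" using Query.prems by auto
  then have "BISE_answer G A B ?r" using assms(1) by (auto simp: BISE_oracle_def)
  then have g: "guarantees G Q (nxt ?r) (n - 1)" using Query.prems by auto
  from Query.IH[OF _ g, of "h @ [((A, B), ?r)]"] obtain h' where
    h': "Q (snd (exec_from orc (nxt ?r) (h @ [((A, B), ?r)])))"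
    "fst (exec_from orc (nxt ?r) (h @ [((A, B), ?r)])) = h @ ((A, B), ?r) # h'"
    "length h' \<le> n - 1" "\<forall>((A, B), r) \<in> set h'. legal_query (pverts G) A B"
    by auto
  then show ?case using legal n by (auto simp: Let_def intro!: exI[of _ "((A, B), ?r) # h'"])
qed

section \<open>Exploring neighbourhoods\<close>

text \<open>The rest of the algorithm is the continuation \<open>c\<close>. Leaving \<open>D\<close>
  out of the query makes every returned neighbour new.\<close>

primrec probe :: "'v set \<Rightarrow> nat \<Rightarrow> 'v \<Rightarrow> 'v set \<Rightarrow> ('v set \<Rightarrow> ('v, 'o) query_alg) \<Rightarrow>
    ('v, 'o) query_alg" where
  "probe V 0 u D c = c D"
| "probe V (Suc n) u D c =
     (if V - insert u D = {} then c D
      else Query {u} (V - insert u D)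
        (\<lambda>r. case r of None \<Rightarrow> c D | Some (_, v) \<Rightarrow> probe V n u (insert v D) c))"

primrec explore :: "'v set \<Rightarrow> nat \<Rightarrow> 'v list \<Rightarrow> ('v \<times> 'v) set \<Rightarrow>
    (('v \<times> 'v) set \<Rightarrow> 'o) \<Rightarrow> ('v, 'o) query_alg" where
  "explore V k [] E f = Output (f E)"
| "explore V k (u # us) E f = probe V (Suc k) u {} (\<lambda>D. explore V k us (E \<union> {u} \<times> D) f)"

definition resolved :: "'v pair_pre_digraph \<Rightarrow> nat \<Rightarrow> ('v \<times> 'v) set \<Rightarrow> 'v \<Rightarrow> bool" where
  "resolved G k E u \<longleftrightarrow> k < card (E `` {u}) \<or> parcs G `` {u} \<subseteq> E `` {u}"

text \<open>Each returned edge enlarges \<open>D\<close> by one, which keeps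
  \<open>card D + n = Suc k\<close>: the fuel runs out exactly when \<open>k + 1\<close> neighbours
  are known, and an earlier stop means that none is missing.\<close>

lemma probe_guarantees:
  assumes G: "pair_graph G" and u: "u \<in> pverts G"
    and D: "D \<subseteq> parcs G `` {u}" "card D + n = Suc k"
    and c: "\<And>D. D \<subseteq> parcs G `` {u} \<Longrightarrow> k < card D \<or> parcs G `` {u} \<subseteq> D \<Longrightarrow>
      guarantees G Q (c D) m"
  shows "guarantees G Q (probe (pverts G) n u D c) (n + m)"
  using D
proof (induction n arbitrary: D)
  case 0
  then show ?case using c by simp
next
  case (Suc n)
  interpret pair_graph G by (rule G)
  have fin: "finite D"
    using Suc.prems(1) pair_finite_arcs by (meson finite_Image finite_subset)
  have nbrs: "parcs G `` {u} \<subseteq> pverts G - {u}"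
    by (auto dest: arc_snd_in_verts pair_no_loops)
  have known: "guarantees G Q (c D) (n + m)" if "parcs G `` {u} \<subseteq> D"
    by (rule guarantees_mono[of G Q _ m]) (use c[of D] Suc.prems that in auto)
  show ?case
  proof (cases "pverts G - insert u D = {}")
    case True
    have "guarantees G Q (c D) (Suc n + m)"
      by (rule guarantees_mono[OF known]) (use True nbrs in auto)
    then show ?thesis using True by simp
  next
    case False
    have "guarantees G Q (case r of None \<Rightarrow> c D | Some (_, v) \<Rightarrow>
        probe (pverts G) n u (insert v D) c) (n + m)"
      if r: "BISE_answer G {u} (pverts G - insert u D) r" for r
    proof (cases r)
      case None
      then have "parcs G `` {u} \<subseteq> D" using r nbrs by (auto simp: BISE_answer_def)
      then show ?thesis using None known by simp
    next
      case (Some p)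
      obtain a v where p: "p = (a, v)" by (cases p)
      have "v \<notin> D" "v \<in> parcs G `` {u}" using r Some p by (auto simp: BISE_answer_def)
      then show ?thesis using Suc.IH[of "insert v D"] Suc.prems fin Some p by simp
    qed
    then show ?thesis using False u by (auto simp: legal_query_def)
  qed
qed

text \<open>Being resolved survives the addition of further arcs of the finite graph, so vertices
  handled earlier stay resolved.\<close>

lemma explore_guarantees:
  assumes G: "pair_graph G" and "set us \<subseteq> pverts G" "E \<subseteq> parcs G"
    and "\<And>E'. E \<subseteq> E' \<Longrightarrow> E' \<subseteq> parcs G \<Longrightarrow> \<forall>u\<in>set us. resolved G k E' u \<Longrightarrow> Q (f E')"
  shows "guarantees G Q (explore (pverts G) k us E f) (length us * Suc k)"
  using assms(2-)
proof (induction us arbitrary: E)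
  case Nil
  then show ?case by simp
next
  case (Cons u us)
  interpret pair_graph G by (rule G)
  have "guarantees G Q (explore (pverts G) k us (E \<union> {u} \<times> D) f) (length us * Suc k)"
    if D: "D \<subseteq> parcs G `` {u}" "k < card D \<or> parcs G `` {u} \<subseteq> D" for D
  proof (rule Cons.IH)
    show "set us \<subseteq> pverts G" "E \<union> {u} \<times> D \<subseteq> parcs G" using Cons.prems(1,2) D by auto
    fix E' assume E': "E \<union> {u} \<times> D \<subseteq> E'" "E' \<subseteq> parcs G" "\<forall>u\<in>set us. resolved G k E' u"
    have "finite (E' `` {u})"
      by (rule finite_Image[OF finite_subset[OF E'(2) pair_finite_arcs]])
    moreover have sub: "D \<subseteq> E' `` {u}" using E'(1) by auto
    ultimately have "card D \<le> card (E' `` {u})" by (rule card_mono)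
    then have "resolved G k E' u"
      using D(2) sub unfolding resolved_def by (metis less_le_trans subset_trans)
    then show "Q (f E')" using E' by (intro Cons.prems(3)) auto
  qed
  then have "guarantees G Q (probe (pverts G) (Suc k) u {}
      (\<lambda>D. explore (pverts G) k us (E \<union> {u} \<times> D) f)) (Suc k + length us * Suc k)"
    using Cons.prems(1) by (intro probe_guarantees[OF G]) auto
  then show ?case by (simp add: add_ac del: probe.simps)
qed

text \<open>Only queries are counted, so a cover of the discovered arcs may simply be chosen; the
  promised cover of the graph shows that one exists.\<close>

definition small_cover :: "'v set \<Rightarrow> nat \<Rightarrow> ('v \<times> 'v) set \<Rightarrow> 'v set" where
  "small_cover V k E = (SOME T. T \<subseteq> V \<and> card T \<le> k \<and> (\<forall>(u, v)\<in>E. u \<in> T \<or> v \<in> T))"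

lemma small_cover_vertex_cover:
  assumes G: "pair_graph G" and S: "vertex_cover G S" "card S \<le> k"
    and M: "vertex_cover G M" "\<forall>u\<in>M. resolved G k E u" and E: "E \<subseteq> parcs G"
  shows "vertex_cover G (small_cover (pverts G) k E) \<and> card (small_cover (pverts G) k E) \<le> k"
proof -
  interpret pair_graph G by (rule G)
  let ?P = "\<lambda>T. T \<subseteq> pverts G \<and> card T \<le> k \<and> (\<forall>(u, v)\<in>E. u \<in> T \<or> v \<in> T)"
  define T where "T = small_cover (pverts G) k E"
  have "?P S" using S E by (auto simp: vertex_cover_def)
  then have T: "?P T" unfolding T_def small_cover_def by (rule someI)
  have fin: "finite T" using T pair_finite_verts finite_subset by blast
  have half: "a \<in> T \<or> b \<in> T" if ab: "(a, b) \<in> parcs G" "a \<in> M" for a b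
  proof (cases "k < card (E `` {a})")
    case True
    \<comment> \<open>At most \<open>k\<close> vertices cannot include all of more than
      \<open>k\<close> neighbours; the discovered edge to a missed one forces \<open>a\<close> into
      \<open>T\<close>.\<close>
    have "\<not> E `` {a} \<subseteq> T"
    proof
      assume "E `` {a} \<subseteq> T"
      from card_mono[OF fin this] show False using True T by simp
    qed
    then show ?thesis using T by blast
  next
    case False
    then have "(a, b) \<in> E" using M(2) ab by (auto simp: resolved_def)
    then show ?thesis using T by blast
  qed
  have "a \<in> T \<or> b \<in> T" if "(a, b) \<in> parcs G" for a b
  proof -
    have "(b, a) \<in> parcs G" using pair_sym_arcs that by (auto simp: symmetric_def dest: symD)
    then show ?thesis using M(1) that half unfolding vertex_cover_def by blast
  qed
  then show ?thesis using T by (auto simp: vertex_cover_def T_def[symmetric])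
qed

section \<open>A maximal matching from random bipartitions\<close>

text \<open>The list holds the bipartitions drawn in advance, \<open>M\<close> both ends of each
  matching edge. A bipartition with an empty side would be an illegal query and separates nothing,
  so it is skipped.\<close>

primrec greedy :: "'v set \<Rightarrow> 'v set list \<Rightarrow> 'v list \<Rightarrow> ('v list \<Rightarrow> ('v, 'o) query_alg) \<Rightarrow>
    ('v, 'o) query_alg" where
  "greedy V [] M c = c M"
| "greedy V (A # As) M c =
     (if A \<inter> (V - set M) = {} \<or> V - set M - A = {} then greedy V As M c
      else Query (A \<inter> (V - set M)) (V - set M - A)
        (\<lambda>r. case r of None \<Rightarrow> greedy V As M c | Some (u, v) \<Rightarrow> greedy V As (u # v # M) c))"

lemma greedy_guarantees:
  assumes "set M \<subseteq> pverts G"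
    and "\<And>M'. set M \<subseteq> set M' \<Longrightarrow> set M' \<subseteq> pverts G \<Longrightarrow>
      length M' \<le> length M + 2 * length As \<Longrightarrow> guarantees G Q (c M') n"
  shows "guarantees G Q (greedy (pverts G) As M c) (length As + n)"
  using assms
proof (induction As arbitrary: M)
  case Nil
  then show ?case by simp
next
  case (Cons A As)
  let ?R = "pverts G - set M"
  have skip: "guarantees G Q (greedy (pverts G) As M c) (length As + n)"
    using Cons.prems by (intro Cons.IH) auto
  show ?case
  proof (cases "A \<inter> ?R = {} \<or> ?R - A = {}")
    case True
    then show ?thesis using guarantees_mono[OF skip, of "length (A # As) + n" Q] by simp
  next
    case False
    have "guarantees G Q (case r of None \<Rightarrow> greedy (pverts G) As M c
        | Some (u, v) \<Rightarrow> greedy (pverts G) As (u # v # M) c) (length As + n)"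
      if r: "BISE_answer G (A \<inter> ?R) (?R - A) r" for r
    proof (cases r)
      case None
      then show ?thesis using skip by simp
    next
      case (Some p)
      obtain u v where p: "p = (u, v)" by (cases p)
      have "guarantees G Q (greedy (pverts G) As (u # v # M) c) (length As + n)"
        using r Some p Cons.prems by (intro Cons.IH) (auto simp: BISE_answer_def)
      then show ?thesis using Some p by simp
    qed
    then show ?thesis using False by (auto simp: legal_query_def)
  qed
qed

text \<open>Conditioning on the first draw, which is independent of the other
  \<open>n\<close>.\<close>

lemma prob_replicate_pmf_of_set_Suc:
  assumes "finite C" "C \<noteq> {}"
  shows "measure_pmf.prob (replicate_pmf (Suc n) (pmf_of_set C)) X =
    (\<Sum>A\<in>C. measure_pmf.prob (replicate_pmf n (pmf_of_set C)) {As. A # As \<in> X}) / card C"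
proof -
  let ?p = "replicate_pmf n (pmf_of_set C)"
  have fin: "finite (set_pmf ?p)"
    using finite_lists_length_eq[OF assms(1), of n] assms
    by (simp add: set_replicate_pmf lists_eq_set)
  have "measure_pmf.prob (replicate_pmf (Suc n) (pmf_of_set C)) X =
      measure_pmf.expectation (pmf_of_set C \<bind> (\<lambda>A. map_pmf ((#) A) ?p)) (indicator X)"
    by (simp add: map_pmf_def)
  also have "\<dots> = (\<Sum>A\<in>C. measure_pmf.prob (map_pmf ((#) A) ?p) X) / card C"
    using assms fin by (subst pmf_expectation_bind_pmf_of_set) (simp_all add: divide_inverse sum_distrib_left mult.commute)
  finally show ?thesis by (simp add: vimage_def)
qed

text \<open>
  Toggling the vertex \<open>a\<close> pairs up the sets separating \<open>a\<close> from \<open>b\<close> with those that do not.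
\<close>

lemma sum_Pow_separating:
  fixes g :: "'a set \<Rightarrow> real"
  assumes "finite V" "a \<in> V" "a \<noteq> b"
    and "\<And>A. A \<subseteq> V \<Longrightarrow> g A \<le> x" "\<And>A. A \<subseteq> V \<Longrightarrow> (a \<in> A) \<noteq> (b \<in> A) \<Longrightarrow> g A \<le> x / 2"
  shows "(\<Sum>A\<in>Pow V. g A) / card (Pow V) \<le> 3 / 4 * x"
proof -
  define t where "t A = (if a \<in> A then A - {a} else insert a A)" for A
  have "(\<Sum>A\<in>Pow V. g (t A)) = (\<Sum>A\<in>Pow V. g A)"
    by (rule sum.reindex_bij_witness[of _ t t]) (use assms(2) in \<open>auto simp: t_def\<close>)
  then have "2 * (\<Sum>A\<in>Pow V. g A) = (\<Sum>A\<in>Pow V. g A + g (t A))"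
    by (simp add: sum.distrib)
  also have "\<dots> \<le> (\<Sum>A\<in>Pow V. 3 / 2 * x)"
  proof (rule sum_mono)
    fix A assume A: "A \<in> Pow V"
    then have tA: "t A \<subseteq> V" using assms(2) by (auto simp: t_def)
    consider "(a \<in> A) \<noteq> (b \<in> A)" | "(a \<in> t A) \<noteq> (b \<in> t A)"
      using assms(3) unfolding t_def by (cases "a \<in> A"; cases "b \<in> A") auto
    then show "g A + g (t A) \<le> 3 / 2 * x"
    proof cases
      case 1
      then show ?thesis using assms(4)[OF tA] assms(5)[of A] A by simp
    next
      case 2
      then show ?thesis using assms(4)[of A] assms(5)[OF tA] A by simp
    qed
  qed
  finally have "2 * (\<Sum>A\<in>Pow V. g A) \<le> card (Pow V) * (3 / 2 * x)" by simp
  moreover have "0 < card (Pow V)" using assms(1) by (simp add: card_Pow)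
  ultimately show ?thesis by (simp add: field_simps)
qed

text \<open>The current answer depends on \<open>h\<close> and \<open>A\<close> but not on the sets
  still to be drawn, so the induction hypothesis applies to the extended transcript.\<close>

lemma greedy_failure_prob:
  assumes G: "pair_graph G" and orc: "BISE_oracle G orc" and S: "vertex_cover G S"
    and c: "\<And>M. set M \<subseteq> pverts G \<Longrightarrow> vertex_cover G (set M) \<Longrightarrow> guarantees G Q (c M) (length M * m)"
  shows "set M \<subseteq> pverts G \<Longrightarrow>
    measure_pmf.prob (replicate_pmf n (pmf_of_set (Pow (pverts G))))
      {As. \<not> Q (snd (exec_from orc (greedy (pverts G) As M c) h))}
    \<le> 2 ^ card (S - set M) * (3 / 4) ^ n"
proof (induction n arbitrary: M h)
  case 0
  show ?case
    by (rule order_trans[OF measure_pmf.prob_le_1]) simp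
next
  case (Suc n)
  interpret pair_graph G by (rule G)
  let ?p = "replicate_pmf n (pmf_of_set (Pow (pverts G)))"
  let ?bad = "\<lambda>M h. {As. \<not> Q (snd (exec_from orc (greedy (pverts G) As M c) h))}"
  let ?x = "2 ^ card (S - set M) * (3 / 4) ^ n :: real"
  have finS: "finite S"
    using S pair_finite_verts unfolding vertex_cover_def by (meson finite_subset)
  show ?case
  proof (cases "vertex_cover G (set M)")
    case True
    \<comment> \<open>A cover stays a cover as \<open>M\<close> grows, so failure is
      impossible.\<close>
    have "Q (snd (exec_from orc (greedy (pverts G) As M c) h))" for As
    proof -
      have "guarantees G Q (greedy (pverts G) As M c)
          (length As + (length M + 2 * length As) * m)"
      proof (rule greedy_guarantees[OF Suc.prems])
        fix M' assume M': "set M \<subseteq> set M'" "set M' \<subseteq> pverts G" "length M' \<le> length M + 2 * length As"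
        then have "vertex_cover G (set M')" using True unfolding vertex_cover_def by blast
        then show "guarantees G Q (c M') ((length M + 2 * length As) * m)"
          using M' by (intro guarantees_mono[OF c]) auto
      qed
      from guarantees_exec[OF orc this] show ?thesis by blast
    qed
    then show ?thesis by simp
  next
    case False
    \<comment> \<open>This uncovered edge is fixed before \<open>A\<close> is drawn. If
      \<open>A\<close> separates its ends, the query is legal and the answer is not NULL.\<close>
    then obtain a b where ab: "(a, b) \<in> parcs G" "a \<notin> set M" "b \<notin> set M"
      using Suc.prems by (auto simp: vertex_cover_def)
    have verts: "a \<in> pverts G" "b \<in> pverts G" "a \<noteq> b" and ba: "(b, a) \<in> parcs G"
      using ab(1) arc_fst_in_verts arc_snd_in_verts pair_no_loops pair_sym_arcs
      by (fastforce simp: symmetric_def dest: symD)+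
    let ?R = "pverts G - set M"
    have step: "measure_pmf.prob ?p {As. A # As \<in> ?bad M h} \<le> ?x \<and>
        ((a \<in> A) \<noteq> (b \<in> A) \<longrightarrow> measure_pmf.prob ?p {As. A # As \<in> ?bad M h} \<le> ?x / 2)" for A
    proof (cases "A \<inter> ?R = {} \<or> ?R - A = {}")
      case True
      then have "\<not> (a \<in> A) \<noteq> (b \<in> A)" using ab verts by blast
      then show ?thesis using Suc.IH[OF Suc.prems, of h] True by simp
    next
      case False
      let ?r = "orc h (A \<inter> ?R) (?R - A)"
      let ?h = "h @ [((A \<inter> ?R, ?R - A), ?r)]"
      have "legal_query (pverts G) (A \<inter> ?R) (?R - A)" using False by (auto simp: legal_query_def)
      then have r: "BISE_answer G (A \<inter> ?R) (?R - A) ?r" using orc by (auto simp: BISE_oracle_def)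
      show ?thesis
      proof (cases ?r)
        case None
        \<comment> \<open>The arc \<open>(a, b)\<close> serves if \<open>a\<close> is in
          \<open>A\<close>, the arc \<open>(b, a)\<close> if \<open>b\<close> is.\<close>
        then have "\<not> (a \<in> A) \<noteq> (b \<in> A)" using r ab ba verts by (auto simp: BISE_answer_def)
        then show ?thesis using Suc.IH[OF Suc.prems, of ?h] None False by (auto simp: Let_def)
      next
        case (Some p)
        obtain u v where p: "p = (u, v)" by (cases p)
        have uv: "u \<in> ?R" "v \<in> ?R" "(u, v) \<in> parcs G"
          using r Some p by (auto simp: BISE_answer_def)
        \<comment> \<open>\<open>S\<close> contains an end of the returned edge and both ends lie
          outside \<open>M\<close>, so the potential at least halves, whether or not
          \<open>A\<close> separates \<open>a\<close> from \<open>b\<close>.\<close>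
        then have "S - set (u # v # M) \<subset> S - set M" using S by (auto simp: vertex_cover_def)
        then have "card (S - set (u # v # M)) < card (S - set M)"
          using finS by (intro psubset_card_mono) auto
        then have "(2::real) ^ Suc (card (S - set (u # v # M))) \<le> 2 ^ card (S - set M)"
          by (intro power_increasing) auto
        then have "2 ^ card (S - set (u # v # M)) * (3 / 4) ^ n \<le> ?x / 2"
          by (simp add: mult_right_mono)
        moreover have "measure_pmf.prob ?p (?bad (u # v # M) ?h) \<le>
            2 ^ card (S - set (u # v # M)) * (3 / 4) ^ n"
          using uv Suc.prems by (intro Suc.IH) auto
        ultimately have half: "measure_pmf.prob ?p (?bad (u # v # M) ?h) \<le> ?x / 2"
          by linarith
        then have full: "measure_pmf.prob ?p (?bad (u # v # M) ?h) \<le> ?x"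
          by (rule order_trans) simp
        have bad: "{As. A # As \<in> ?bad M h} = ?bad (u # v # M) ?h"
          using False Some p by (simp add: Let_def)
        show ?thesis unfolding bad by (intro conjI impI half full)
      qed
    qed
    have "measure_pmf.prob (replicate_pmf (Suc n) (pmf_of_set (Pow (pverts G)))) (?bad M h) \<le>
        3 / 4 * ?x"
    proof (subst prob_replicate_pmf_of_set_Suc)
      show "(\<Sum>A\<in>Pow (pverts G). measure_pmf.prob ?p {As. A # As \<in> ?bad M h}) /
          card (Pow (pverts G)) \<le> 3 / 4 * ?x"
        by (rule sum_Pow_separating[OF pair_finite_verts verts(1,3)]) (use step in blast)+
    qed (use pair_finite_verts in auto)
    then show ?thesis by simp
  qed
qed

section \<open>The query algorithm\<close>

definition cover_alg :: "'v set \<Rightarrow> nat \<Rightarrow> 'v set list \<Rightarrow> ('v, 'v set) query_alg" where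
  "cover_alg V k As = greedy V As [] (\<lambda>M. explore V k M {} (small_cover V k))"

definition random_cover_alg :: "'v set \<Rightarrow> nat \<Rightarrow> ('v, 'v set) query_alg pmf" where
  "random_cover_alg V k = map_pmf (cover_alg V k) (replicate_pmf (5 * k) (pmf_of_set (Pow V)))"

text \<open>The postcondition is trivial because the query bound must hold for every draw, even if
  the matching found is not maximal.\<close>

lemma cover_alg_guarantees:
  assumes "pair_graph G"
  shows "guarantees G (\<lambda>_. True) (cover_alg (pverts G) k As)
    (length As + 2 * length As * Suc k)"
  unfolding cover_alg_def
proof (rule greedy_guarantees)
  fix M assume "set M \<subseteq> pverts G" "length M \<le> length ([] :: 'a list) + 2 * length As"
  then show "guarantees G (\<lambda>_. True) (explore (pverts G) k M {} (small_cover (pverts G) k))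
      (2 * length As * Suc k)"
    by (intro guarantees_mono[OF explore_guarantees[OF assms, where Q = "\<lambda>_. True"]])
      (auto intro: mult_right_mono simp del: mult_Suc_right)
qed simp

lemma cover_alg_failure_prob:
  assumes G: "pair_graph G" and orc: "BISE_oracle G orc"
    and S: "vertex_cover G S" "card S \<le> k"
  shows "measure_pmf.prob (random_cover_alg (pverts G) k)
    {t. \<not> (vertex_cover G (result orc t) \<and> card (result orc t) \<le> k)} \<le> 2 ^ k * (3 / 4) ^ (5 * k)"
proof -
  have "measure_pmf.prob (random_cover_alg (pverts G) k)
      {t. \<not> (vertex_cover G (result orc t) \<and> card (result orc t) \<le> k)} \<le>
      2 ^ card (S - set []) * (3 / 4) ^ (5 * k)"
    unfolding random_cover_alg_def measure_map_pmf vimage_def cover_alg_def result_def mem_Collect_eq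
  proof (rule greedy_failure_prob[OF G orc S(1)])
    fix M assume M: "set M \<subseteq> pverts G" "vertex_cover G (set M)"
    show "guarantees G (\<lambda>T. vertex_cover G T \<and> card T \<le> k)
        (explore (pverts G) k M {} (small_cover (pverts G) k)) (length M * Suc k)"
      using M(1) small_cover_vertex_cover[OF G S M(2)] by (intro explore_guarantees[OF G]) auto
  qed simp
  also have "\<dots> \<le> 2 ^ k * (3 / 4) ^ (5 * k)"
    using S(2) by (intro mult_right_mono power_increasing) auto
  finally show ?thesis .
qed

theorem theorem4:
  shows "\<exists>(alg :: 'v set \<Rightarrow> nat \<Rightarrow> ('v, 'v set) query_alg pmf) (q :: nat \<Rightarrow> nat) (c :: real).
    (\<lambda>k. real (q k)) \<in> O(\<lambda>k. real k ^ 2 * ln (real k)) \<and> c > 0 \<and>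
    (\<forall>(k :: nat) (G :: 'v pair_pre_digraph) (orc :: 'v query_oracle).
       k \<ge> 1 \<longrightarrow> pair_graph G \<longrightarrow> (\<exists>S. vertex_cover G S \<and> card S \<le> k) \<longrightarrow> BISE_oracle G orc \<longrightarrow>
         (\<forall>t \<in> set_pmf (alg (pverts G) k).
            legal_run (pverts G) orc t \<and> num_queries orc t \<le> q k) \<and>
         measure_pmf.prob (alg (pverts G) k)
           {t. vertex_cover G (result orc t) \<and> card (result orc t) \<le> k}
           \<ge> 1 - 1 / real k powr c)"
proof (intro exI conjI allI impI)
  \<comment> \<open>One query per bipartition, then at most \<open>Suc k\<close> for each of at most
    \<open>2 * (5 * k)\<close> matched vertices.\<close>
  let ?q = "\<lambda>k :: nat. 5 * k + 2 * (5 * k) * Suc k"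
  show "(\<lambda>k. real (?q k)) \<in> O(\<lambda>k. real k ^ 2 * ln (real k))"
  \<comment> \<open>The count is \<open>10 * k ^ 2 + 15 * k\<close>, at most
    \<open>25 * k ^ 2\<close>; from \<open>k = 3\<close> on, \<open>ln k\<close> is at least
    1.\<close>
  proof (rule bigoI[of _ 25], rule eventually_mono[OF eventually_ge_at_top[of 3]])
    fix k :: nat assume k: "3 \<le> k"
    have "exp 1 \<le> real k" using exp_le k by linarith
    then have "1 \<le> ln (real k)" using k by (subst ln_ge_iff) auto
    then have ln: "real k ^ 2 * 1 \<le> real k ^ 2 * ln (real k)" by (rule mult_left_mono) simp
    have "?q k \<le> 25 * k ^ 2" using k by (simp add: power2_eq_square)
    then have "real (?q k) \<le> real (25 * k ^ 2)" by (rule of_nat_mono)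
    also have "\<dots> = 25 * (real k ^ 2 * 1)" by simp
    also have "\<dots> \<le> 25 * (real k ^ 2 * ln (real k))" using ln by simp
    finally show "norm (real (?q k)) \<le> 25 * norm (real k ^ 2 * ln (real k))" by simp
  qed
  show "(1::real) > 0" by simp
  fix k :: nat and G :: "'v pair_pre_digraph" and orc :: "'v query_oracle"
  assume k: "k \<ge> 1" and G: "pair_graph G" and S: "\<exists>S. vertex_cover G S \<and> card S \<le> k"
    and orc: "BISE_oracle G orc"
  interpret pair_graph G by (rule G)
  show "\<forall>t \<in> set_pmf (random_cover_alg (pverts G) k).
      legal_run (pverts G) orc t \<and> num_queries orc t \<le> ?q k"
  proof
    fix t assume "t \<in> set_pmf (random_cover_alg (pverts G) k)"
    then obtain As where "length As = 5 * k" "t = cover_alg (pverts G) k As"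
      by (auto simp: random_cover_alg_def set_replicate_pmf)
    then have "guarantees G (\<lambda>_. True) t (?q k)"
      using cover_alg_guarantees[OF G, of k As] by simp
    from guarantees_exec[OF orc this, of "[]"]
    show "legal_run (pverts G) orc t \<and> num_queries orc t \<le> ?q k"
      by (auto simp: legal_run_def num_queries_def transcript_def)
  qed
  let ?p = "random_cover_alg (pverts G) k"
  let ?good = "{t. vertex_cover G (result orc t) \<and> card (result orc t) \<le> k}"
  have "measure_pmf.prob ?p (- ?good) \<le> 2 ^ k * (3 / 4) ^ (5 * k)"
    using cover_alg_failure_prob[OF G orc] S by (auto simp: Collect_neg_eq[symmetric])
  also have "\<dots> = (2 * (3 / 4) ^ 5) ^ k" by (simp add: power_mult power_mult_distrib)
  \<comment> \<open>Five bipartitions per cover vertex suffice here: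
    \<open>2 * (3/4) ^ 5 = 486/1024\<close>, whereas four would give \<open>162/256\<close>, above
    one half.\<close>
  also have "\<dots> \<le> (1 / 2) ^ k" by (intro power_mono) (auto simp: power_numeral_reduce)
  also have "\<dots> = 1 / 2 ^ k" by (simp add: power_divide)
  also have "\<dots> \<le> 1 / real k"
    using k of_nat_less_two_power[of k, where 'a = real] by (intro divide_left_mono) auto
  finally show "measure_pmf.prob ?p ?good \<ge> 1 - 1 / real k powr 1"
    using measure_pmf.prob_compl[of ?good ?p] k by (simp add: Compl_eq_Diff_UNIV)
qed

end
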